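(* Let $0<\rho\le1$, let $a\in C^\rho(\mathbb T)$ be complex-valued, and suppose that $$v(x)=\sum_{\nu=1}^N\Gamma_\nu L_{\xi_\nu}(x)+C(x),\qquad C\in C^0(\mathbb T),$$ in distributions, with $\xi_\nu\in\mathbb T$ and $\Gamma_\nu\in\mathbb C$; use for $v$ the locally integrable representative supplied by the right-hand side, so that the product $av$ is well defined. Then there is $C_a\in C^0(\mathbb T)$ with $$a(x)v(x)=\sum_{\nu=1}^Na(\xi_\nu)\Gamma_\nu L_{\xi_\nu}(x)+C_a(x)$$ in distributions and pointwise away from the finite set $\{\xi_1,\dots,\xi_N\}$. Consequently, if $$U(x)=2\,\mathrm{Re}\big(a(x)\,i\,v(x)\big)+r(x),\qquad r\in C^0(\mathbb T),$$ then there is $R\in C^0(\mathbb T)$ with $$U(x)=2\,\mathrm{Re}\sum_{\nu=1}^N i\,a(\xi_\nu)\Gamma_\nu L_{\xi_\nu}(x)+R(x).$$ Equivalently, $$U(x)=\sum_{\nu=1}^N\big(A_\nu\,\mathcal C_{\xi_\nu}(x)+B_\nu\,\mathcal J_{\xi_\nu}(x)\big)+R(x),$$ with $A_\nu=2\,\mathrm{Re}(i\,a(\xi_\nu)\Gamma_\nu)$ and $B_\nu=-2\,\mathrm{Im}(i\,a(\xi_\nu)\Gamma_\nu)$.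
   Context: $\mathbb T=\mathbb R/2\pi\mathbb Z$, and $C^\rho(\mathbb T)$ is the space of Hölder continuous functions of exponent $\rho$ (Lipschitz when $\rho=1$). For $\xi\in\mathbb T$, $L_\xi(x)=-\log(1-e^{i(x-\xi)})$ with the principal boundary value, equivalently $L_\xi(x)=\sum_{n\ge1}\frac{e^{in(x-\xi)}}n$ as a distribution. One has $L_\xi=\mathcal C_\xi+i\mathcal J_\xi$, where $\mathcal C_\xi(x)=-\log\left|2\sin\frac{x-\xi}{2}\right|$ and $\mathcal J_\xi(x)=\frac{\pi-y_\xi(x)}2$, with $y_\xi(x)\in(0,2\pi)$, $y_\xi(x)\equiv x-\xi\pmod{2\pi}$. *)

theory Defs
  imports "HOL-Analysis.Analysis" "HOL-Library.Real_Mod"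
begin

text \<open>
  Points of the circle \<open>\<real>/2\<pi>\<int>\<close> are represented by real numbers, and functions on the circle by
  \<open>2\<pi>\<close>-periodic functions on the real line.
\<close>

abbreviation periodic_2pi :: "(real \<Rightarrow> 'b) \<Rightarrow> bool" where
  "periodic_2pi f \<equiv> periodic_fun_simple f (2 * pi)"

definition C0_circle :: "(real \<Rightarrow> 'b :: topological_space) set" where
  "C0_circle = {f. periodic_2pi f \<and> continuous_on UNIV f}"

text \<open>
  The distance of two points of the circle is the minimum of \<open>\<bar>x - y\<bar>\<close> over their representatives,
  so for periodic \<open>f\<close> the estimate below is the Hoelder estimate with respect to that distance.
\<close>

definition Holder_circle :: "real \<Rightarrow> (real \<Rightarrow> 'b :: metric_space) set" where
  "Holder_circle \<rho> =
     {f. periodic_2pi f \<and> (\<exists>K. \<forall>x y. dist (f x) (f y) \<le> K * \<bar>x - y\<bar> powr \<rho>)}"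

definition iter_deriv :: "nat \<Rightarrow> (real \<Rightarrow> complex) \<Rightarrow> real \<Rightarrow> complex" where
  "iter_deriv k = (\<lambda>f x. vector_derivative f (at x)) ^^ k"

definition test_functions :: "(real \<Rightarrow> complex) set" where
  "test_functions =
     {\<phi>. periodic_2pi \<phi> \<and> (\<forall>k x. iter_deriv k \<phi> differentiable at x)}"

text \<open>
  A distribution is a linear functional on the test functions that is continuous for the Frechet
  topology given by the seminorms \<open>\<phi> \<mapsto> sup \<bar>\<phi>\<^sup>(\<^sup>j\<^sup>)\<bar>\<close>; its values outside the test functions are
  irrelevant, so equality of distributions is \<open>distr_eq\<close> and not equality of functionals.
\<close>

definition is_distribution :: "((real \<Rightarrow> complex) \<Rightarrow> complex) \<Rightarrow> bool" where
  "is_distribution u \<longleftrightarrow>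
     (\<forall>\<phi>\<in>test_functions. \<forall>\<psi>\<in>test_functions. u (\<lambda>x. \<phi> x + \<psi> x) = u \<phi> + u \<psi>) \<and>
     (\<forall>c. \<forall>\<phi>\<in>test_functions. u (\<lambda>x. c * \<phi> x) = c * u \<phi>) \<and>
     (\<exists>K m. \<forall>\<phi>\<in>test_functions.
        norm (u \<phi>) \<le> K * (\<Sum>j\<le>m. SUP x\<in>{0..2*pi}. norm (iter_deriv j \<phi> x)))"

definition distr_eq ::
    "((real \<Rightarrow> complex) \<Rightarrow> complex) \<Rightarrow> ((real \<Rightarrow> complex) \<Rightarrow> complex) \<Rightarrow> bool"  (infix \<open>=\<^sub>D\<close> 50) where
  "u =\<^sub>D w \<longleftrightarrow> (\<forall>\<phi>\<in>test_functions. u \<phi> = w \<phi>)"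

definition L1_circle :: "(real \<Rightarrow> complex) set" where
  "L1_circle = {f. periodic_2pi f \<and> f absolutely_integrable_on {0..2*pi}}"

definition distr_of :: "(real \<Rightarrow> complex) \<Rightarrow> (real \<Rightarrow> complex) \<Rightarrow> complex" where
  "distr_of f \<phi> = (LINT x:{0..2*pi}|lebesgue. f x * \<phi> x)"

text \<open>
  For \<open>x\<close> not congruent to \<open>\<xi>\<close> the argument of \<open>Ln\<close> has positive real part, so \<open>Ln\<close> is the
  principal boundary value.  The values of the following three functions at the points congruent
  to \<open>\<xi>\<close> carry no meaning.
\<close>

definition Lfun :: "real \<Rightarrow> real \<Rightarrow> complex" where
  "Lfun \<xi> x = - Ln (1 - exp (\<i> * complex_of_real (x - \<xi>)))"

definition Cfun :: "real \<Rightarrow> real \<Rightarrow> real" where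
  "Cfun \<xi> x = - ln \<bar>2 * sin ((x - \<xi>) / 2)\<bar>"

definition Jfun :: "real \<Rightarrow> real \<Rightarrow> real" where
  "Jfun \<xi> x = (pi - (x - \<xi>) rmod (2 * pi)) / 2"

text \<open>All representatives of the points \<open>\<xi> 1, \<dots>, \<xi> N\<close> of the circle.\<close>

definition singular_points :: "nat \<Rightarrow> (nat \<Rightarrow> real) \<Rightarrow> real set" where
  "singular_points N \<xi> = {x. \<exists>\<nu>\<in>{1..N}. [x = \<xi> \<nu>] (rmod (2 * pi))}"

end

theory Submission
  imports Defs "HOL-Real_Asymp.Real_Asymp"
begin

text \<open>
  Multiplying by \<open>a\<close> acts on the singularity of \<open>L\<^bsub>\<xi>\<^esub>\<close> only through the value \<open>a \<xi>\<close>, because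
  \<open>a x L\<^bsub>\<xi>\<^esub>(x) = a \<xi> L\<^bsub>\<xi>\<^esub>(x) + (a x - a \<xi>) L\<^bsub>\<xi>\<^esub>(x)\<close> and the last product is continuous on the whole
  circle: near \<open>\<xi>\<close> it is \<open>O(\<bar>x - \<xi>\<bar>\<^sup>\<rho> log (1 / \<bar>x - \<xi>\<bar>))\<close>, so it extends by \<open>0\<close>
  (\<open>Holder_times_Lfun_continuous\<close>).  Adding these products, weighted by \<open>\<Gamma> \<nu>\<close>, to \<open>a C\<close> gives
  \<open>C\<^sub>a\<close>.  The statements on \<open>U\<close> are the real part of \<open>\<i> a v\<close>, with \<open>R = r + 2 Re (\<i> C\<^sub>a)\<close>, and
  the decomposition \<open>L = \<C> + \<i> \<J>\<close> of \<open>Lfun_eq_Complex\<close>.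

  The estimate behind the extension is \<open>\<bar>x - \<xi>\<bar>\<^sup>s L\<^bsub>\<xi>\<^esub>(x) \<longrightarrow> 0\<close> for every \<open>s > 0\<close>
  (\<open>powr_times_Lfun_tendsto_0\<close>).  The exponent \<open>s = \<rho>\<close> serves the Hoelder factor; the exponent
  \<open>s = 1/2\<close> gives integrability of \<open>L\<^bsub>\<xi>\<^esub>\<close>, by comparison with \<open>\<bar>x - \<xi>\<bar>\<^sup>-\<^sup>1\<^sup>/\<^sup>2\<close>.

  All identities hold off the countable set of representatives of the points \<open>\<xi> \<nu>\<close>.  The functional
  \<open>distr_of\<close> does not see countable sets (\<open>distr_of_cong\<close>), so every identity between distributions
  follows from the pointwise one.
\<close>

section \<open>The logarithm and its real and imaginary parts\<close>

lemma rcong_iff_cis: "[x = \<xi>] (rmod (2 * pi)) \<longleftrightarrow> exp (\<i> * complex_of_real (x - \<xi>)) = 1"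
proof -
  have "[x = \<xi>] (rmod (2 * pi)) \<longleftrightarrow> [x - \<xi> = 0] (rmod (2 * pi))"
    by (metis rcong_0_iff rcong_conv_diff_rmod_eq_0)
  then show ?thesis
    by (simp add: cis_eq_iff[symmetric] cis_conv_exp del: of_real_diff)
qed

text \<open>
  For \<open>y \<in> (0, 2\<pi>)\<close> the half-angle formulas give \<open>1 - e\<^sup>i\<^sup>y = 2 sin (y/2) e\<^sup>i\<^sup>(\<^sup>y\<^sup>-\<^sup>\<pi>\<^sup>)\<^sup>/\<^sup>2\<close>, which is a
  polar decomposition with argument in \<open>(-\<pi>/2, \<pi>/2)\<close>, so \<open>Ln\<close> can be read off.
\<close>
lemma Lfun_eq_Complex:
  assumes "\<not> [x = \<xi>] (rmod (2 * pi))"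
  shows "Lfun \<xi> x = Complex (Cfun \<xi> x) (Jfun \<xi> x)"
proof -
  define y where "y = (x - \<xi>) rmod (2 * pi)"
  have "y \<noteq> 0" using assms by (simp add: y_def rcong_conv_diff_rmod_eq_0)
  then have y: "0 < y" "y < 2 * pi"
    using rmod_nonneg[of "2*pi" "x - \<xi>"] rmod_less[of "2*pi" "x - \<xi>"] by (auto simp: y_def)
  have s: "0 < sin (y / 2)" using y by (intro sin_gt_zero) auto
  have cis: "exp (\<i> * complex_of_real (x - \<xi>)) = cis y"
    unfolding y_def cis_rmod by (rule cis_conv_exp[symmetric])
  have sin: "\<bar>2 * sin ((x - \<xi>) / 2)\<bar> = 2 * sin (y / 2)"
    using dist_exp_i_1[of "x - \<xi>"] dist_exp_i_1[of y] s unfolding cis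
    by (simp add: abs_mult cis_conv_exp)
  have polar: "1 - cis y = 2 * sin (y / 2) * cis ((y - pi) / 2)"
    using sin_double[of "y/2"] cos_double_sin[of "y/2"]
    by (simp add: complex_eq_iff diff_divide_distrib sin_diff cos_diff power2_eq_square)
  have "Ln (1 - cis y) = Complex (ln (2 * sin (y / 2))) ((y - pi) / 2)"
  proof (rule Ln_unique)
    show "exp (Complex (ln (2 * sin (y / 2))) ((y - pi) / 2)) = 1 - cis y"
      using s unfolding polar by (simp add: exp_eq_polar)
  qed (use y in auto)
  then show ?thesis
    unfolding Lfun_def Cfun_def Jfun_def cis sin y_def[symmetric]
    by (simp add: complex_eq_iff field_simps)
qed

lemma Lfun_cong:
  assumes "[\<xi> = \<eta>] (rmod (2 * pi))"
  shows "Lfun \<xi> = Lfun \<eta>"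
proof
  fix x
  have "cis (x - \<xi>) = cis (x - \<eta>)"
    by (rule cis_cong) (rule rcong_diff[OF rcong_refl assms])
  then show "Lfun \<xi> x = Lfun \<eta> x" by (simp add: Lfun_def cis_conv_exp)
qed

lemma periodic_Lfun: "periodic_2pi (Lfun \<xi>)"
proof
  fix x
  have "cis (x + 2 * pi - \<xi>) = cis (x - \<xi>)"
    by (simp add: complex_eq_iff cos_diff sin_diff)
  then show "Lfun \<xi> (x + 2 * pi) = Lfun \<xi> x" by (simp add: Lfun_def cis_conv_exp)
qed

lemma isCont_Lfun:
  assumes "\<not> [x = \<xi>] (rmod (2 * pi))"
  shows "isCont (Lfun \<xi>) x"
proof -
  have "cis (x - \<xi>) \<noteq> 1"
    using assms by (simp add: rcong_iff_cis cis_conv_exp)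
  then have "cos (x - \<xi>) \<noteq> 1"
    using sin_cos_squared_add[of "x - \<xi>"] by (auto simp: complex_eq_iff simp del: sin_cos_squared_add)
  then have "cos (x - \<xi>) < 1"
    using cos_le_one[of "x - \<xi>"] by linarith
  then have "1 - exp (\<i> * complex_of_real (x - \<xi>)) \<notin> \<real>\<^sub>\<le>\<^sub>0"
    unfolding cis_conv_exp[symmetric] by (auto simp: complex_nonpos_Reals_iff)
  then show ?thesis
    unfolding Lfun_def by (intro continuous_intros)
qed

lemma norm_Lfun_le:
  assumes "\<not> [x = \<xi>] (rmod (2 * pi))"
  shows "norm (Lfun \<xi> x) \<le> \<bar>ln \<bar>2 * sin ((x - \<xi>) / 2)\<bar>\<bar> + pi"
proof -
  have "\<bar>Jfun \<xi> x\<bar> \<le> pi"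
    using rmod_nonneg[of "2*pi" "x - \<xi>"] rmod_less[of "2*pi" "x - \<xi>"] by (auto simp: Jfun_def)
  moreover have "norm (Lfun \<xi> x) \<le> \<bar>Cfun \<xi> x\<bar> + \<bar>Jfun \<xi> x\<bar>"
    using cmod_le[of "Lfun \<xi> x"] by (simp add: Lfun_eq_Complex[OF assms])
  ultimately show ?thesis by (simp add: Cfun_def)
qed

lemma eventually_not_rcong: "eventually (\<lambda>x. \<not> [x = p] (rmod (2 * pi))) (at p)"
proof -
  have "eventually (\<lambda>x. dist x p < 2 * pi) (at p)"
    unfolding eventually_at by (intro exI[of _ "2 * pi"]) auto
  then show ?thesis
    using eventually_neq_at_within[of p p UNIV]
    by eventually_elim (auto dest: rcong_imp_eq simp: dist_real_def)
qed

section \<open>Growth at the singularity\<close>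

lemma powr_times_log_sin_tendsto_0:
  assumes "s > 0"
  shows "((\<lambda>t::real. t powr s * (\<bar>ln (2 * sin (t / 2))\<bar> + pi)) \<longlongrightarrow> 0) (at_right 0)"
  using assms by real_asymp

text \<open>
  The point \<open>p\<close> may be any representative of \<open>\<xi>\<close>, since \<open>L\<^bsub>\<xi>\<^esub> = L\<^bsub>p\<^esub>\<close>.  For \<open>0 < \<bar>x - p\<bar> < 2\<pi>\<close>
  the modulus of \<open>L\<^bsub>\<xi>\<^esub>(x)\<close> is at most \<open>\<bar>log (2 sin (\<bar>x - p\<bar>/2))\<bar> + \<pi>\<close>, and a logarithm is beaten by
  every positive power.
\<close>
lemma powr_times_Lfun_tendsto_0:
  assumes "s > 0" "[p = \<xi>] (rmod (2 * pi))"
  shows "((\<lambda>x. \<bar>x - p\<bar> powr s * norm (Lfun \<xi> x)) \<longlongrightarrow> 0) (at p)"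
proof (rule Lim_null_comparison)
  have "filterlim (\<lambda>x. \<bar>x - p\<bar>) (at_right 0) (at p)"
    unfolding filterlim_at
    by (intro conjI tendsto_eq_intros) (auto simp: eventually_at_filter intro!: tendsto_eq_intros)
  from filterlim_compose[OF powr_times_log_sin_tendsto_0[OF assms(1)] this]
  show "((\<lambda>x. \<bar>x - p\<bar> powr s * (\<bar>ln (2 * sin (\<bar>x - p\<bar> / 2))\<bar> + pi)) \<longlongrightarrow> 0) (at p)" .
  have "eventually (\<lambda>x. dist x p < 2 * pi) (at p)"
    unfolding eventually_at by (intro exI[of _ "2 * pi"]) auto
  with eventually_not_rcong show "eventually (\<lambda>x. norm (\<bar>x - p\<bar> powr s * norm (Lfun \<xi> x))
      \<le> \<bar>x - p\<bar> powr s * (\<bar>ln (2 * sin (\<bar>x - p\<bar> / 2))\<bar> + pi)) (at p)"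
  proof eventually_elim
    case (elim x)
    have "0 \<le> sin (\<bar>x - p\<bar> / 2)"
      using elim(2) by (intro sin_ge_zero) (auto simp: dist_real_def)
    moreover have "\<bar>sin ((x - p) / 2)\<bar> = \<bar>sin (\<bar>x - p\<bar> / 2)\<bar>"
      using sin_minus[of "(p - x) / 2"] by (cases "x \<ge> p") (auto simp: minus_divide_left)
    ultimately have "norm (Lfun \<xi> x) \<le> \<bar>ln (2 * sin (\<bar>x - p\<bar> / 2))\<bar> + pi"
      using norm_Lfun_le[OF elim(1)] Lfun_cong[OF assms(2)] by (simp add: abs_mult)
    then show ?case by (simp add: mult_left_mono)
  qed
qed

section \<open>Integrability\<close>

text \<open>
  The hypothesis is imposed at every point \<open>p\<close>, not only at singularities: it then bounds \<open>f\<close>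
  by \<open>\<bar>x - p\<bar>\<^sup>-\<^sup>1\<^sup>/\<^sup>2\<close> in a punctured neighbourhood of each \<open>p\<close>, and integrability on a compact interval
  follows from integrability near each of its points.
\<close>
lemma absolutely_integrable_if_order_less_half:
  fixes f :: "real \<Rightarrow> complex"
  assumes meas: "f \<in> borel_measurable borel"
    and lim: "\<And>p. ((\<lambda>x. sqrt \<bar>x - p\<bar> * norm (f x)) \<longlongrightarrow> 0) (at p)"
  shows "f absolutely_integrable_on {a..b}"
proof (cases "a \<le> b")
  case True
  then show ?thesis
  proof (induction rule: Bolzano)
    case (trans a b c)
    then show ?case by (blast intro: absolutely_integrable_on_combine)
  next
    case (local p)
    have "eventually (\<lambda>x. sqrt \<bar>x - p\<bar> * norm (f x) < 1) (at p)"
      using lim[of p] by (rule order_tendstoD) auto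
    then obtain d where "d > 0"
      and d: "\<And>x. x \<noteq> p \<Longrightarrow> \<bar>x - p\<bar> < d \<Longrightarrow> sqrt \<bar>x - p\<bar> * norm (f x) < 1"
      unfolding eventually_at dist_real_def by auto
    define g where "g x = (if x = p then norm (f p) else 1 / sqrt \<bar>x - p\<bar>)" for x
    have "f absolutely_integrable_on {a..b}" if ab: "a \<le> p" "p \<le> b" "b - a < d" for a b
    proof (rule measurable_bounded_by_integrable_imp_absolutely_integrable)
      show "f \<in> borel_measurable (lebesgue_on {a..b})"
        using meas by (simp add: measurable_completion measurable_restrict_space1)
      \<comment> \<open>The square root is an odd function here, \<open>sqrt (- t) = - sqrt t\<close>, hence \<open>2 * sqrt (x - p)\<close> is
        a continuous antiderivative of \<open>g\<close> on both sides of \<open>p\<close>.\<close>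
      have "(g has_integral 2 * sqrt (b - p) - 2 * sqrt (a - p)) {a..b}"
      proof (rule fundamental_theorem_of_calculus_strong[where S = "{p}"])
        fix x assume "x \<in> {a..b} - {p}"
        then have "(sqrt has_real_derivative g x / 2) (at (x - p))"
          using real_sqrt_minus[of "p - x"]
          by (intro DERIV_real_sqrt_generic) (auto simp: g_def field_simps)
        then have "((\<lambda>x. sqrt (x - p)) has_real_derivative g x / 2 * 1) (at x)"
          by (rule DERIV_chain2) (auto intro!: derivative_eq_intros)
        then have "((\<lambda>x. 2 * sqrt (x - p)) has_real_derivative g x) (at x)"
          using DERIV_cmult[of "\<lambda>x. sqrt (x - p)" "g x / 2" x UNIV 2] by simp
        then show "((\<lambda>x. 2 * sqrt (x - p)) has_vector_derivative g x) (at x)"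
          by (simp add: has_real_derivative_iff_has_vector_derivative)
      qed (use ab in \<open>auto intro!: continuous_intros\<close>)
      then show "g integrable_on {a..b}" by blast
      fix x assume "x \<in> {a..b}"
      then have "x \<noteq> p \<Longrightarrow> sqrt \<bar>x - p\<bar> * norm (f x) < 1"
        using ab by (intro d) auto
      then show "norm (f x) \<le> g x"
        by (auto simp: g_def field_simps)
    qed auto
    with \<open>d > 0\<close> show ?case by blast
  qed
qed (simp add: absolutely_integrable_on_def)

lemma countable_rcong: "countable {x. [x = \<xi>] (rmod (2 * pi))}"
proof -
  have "{x. [x = \<xi>] (rmod (2 * pi))} \<subseteq> range (\<lambda>n. \<xi> - of_int n * (2 * pi))"
    by (auto simp: rcong_altdef)
  then show ?thesis by (rule countable_subset) auto
qed

lemma absolutely_integrable_Lfun: "Lfun \<xi> absolutely_integrable_on {a..b}"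
proof (rule absolutely_integrable_if_order_less_half)
  show "Lfun \<xi> \<in> borel_measurable borel"
    by (rule borel_measurable_continuous_countable_exceptions[OF countable_rcong[of \<xi>]])
       (auto intro!: continuous_at_imp_continuous_on isCont_Lfun)
  show "((\<lambda>x. sqrt \<bar>x - p\<bar> * norm (Lfun \<xi> x)) \<longlongrightarrow> 0) (at p)" for p
  proof (cases "[p = \<xi>] (rmod (2 * pi))")
    case True
    then show ?thesis
      using powr_times_Lfun_tendsto_0[of "1/2" p \<xi>] by (simp add: powr_half_sqrt)
  next
    case False
    from isCont_Lfun[OF this] have "(Lfun \<xi> \<longlongrightarrow> Lfun \<xi> p) (at p)" by (simp add: isCont_def)
    then show ?thesis by (auto intro!: tendsto_eq_intros)
  qed
qed

section \<open>A Hoelder factor that vanishes at the singularity\<close>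

lemma Holder_circle_subset_C0_circle:
  assumes "0 < \<rho>"
  shows "Holder_circle \<rho> \<subseteq> C0_circle"
proof
  fix f :: "real \<Rightarrow> 'b::metric_space" assume f: "f \<in> Holder_circle \<rho>"
  then obtain K where K: "\<And>x y. dist (f x) (f y) \<le> K * \<bar>x - y\<bar> powr \<rho>"
    by (auto simp: Holder_circle_def)
  have "isCont f p" for p
  proof -
    have "((\<lambda>x. K * \<bar>x - p\<bar> powr \<rho>) \<longlongrightarrow> K * \<bar>p - p\<bar> powr \<rho>) (at p)"
      using assms by (intro tendsto_intros tendsto_powr') auto
    then have "((\<lambda>x. K * \<bar>x - p\<bar> powr \<rho>) \<longlongrightarrow> 0) (at p)" by simp
    then have "((\<lambda>x. dist (f x) (f p)) \<longlongrightarrow> 0) (at p)"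
      by (rule Lim_null_comparison[rotated]) (simp add: K)
    then show ?thesis by (simp add: isCont_def tendsto_dist_iff[symmetric])
  qed
  with f show "f \<in> C0_circle"
    by (simp add: C0_circle_def Holder_circle_def continuous_at_imp_continuous_on)
qed

text \<open>
  At a representative \<open>p\<close> of \<open>\<xi>\<close> periodicity gives \<open>a p = a \<xi>\<close>, so the Hoelder estimate centred at
  \<open>p\<close> bounds the product by \<open>K \<bar>x - p\<bar>\<^sup>\<rho> \<bar>L\<^bsub>\<xi>\<^esub>(x)\<bar>\<close>, which tends to \<open>0\<close>.
\<close>
lemma Holder_times_Lfun_continuous:
  fixes a :: "real \<Rightarrow> complex"
  assumes \<rho>: "0 < \<rho>" and a: "a \<in> Holder_circle \<rho>"
  shows "(\<lambda>x. if [x = \<xi>] (rmod (2 * pi)) then 0 else (a x - a \<xi>) * Lfun \<xi> x) \<in> C0_circle"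
    (is "?g \<in> _")
proof -
  interpret a: periodic_fun_simple a "2 * pi" using a by (simp add: Holder_circle_def)
  interpret L: periodic_fun_simple "Lfun \<xi>" "2 * pi" by (rule periodic_Lfun)
  obtain K where K: "\<And>x y. norm (a x - a y) \<le> K * \<bar>x - y\<bar> powr \<rho>"
    using a by (auto simp: Holder_circle_def dist_norm)
  have "isCont ?g p" for p
  proof (cases "[p = \<xi>] (rmod (2 * pi))")
    case True
    then obtain n where "\<xi> = p + of_int n * (2 * pi)" by (auto simp: rcong_altdef)
    then have ap: "a p = a \<xi>" by (simp only: a.plus_of_int)
    have lim: "((\<lambda>x. K * (\<bar>x - p\<bar> powr \<rho> * norm (Lfun \<xi> x))) \<longlongrightarrow> 0) (at p)"
      using tendsto_mult_right_zero[OF powr_times_Lfun_tendsto_0[OF \<rho> True]] .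
    have le: "norm (?g x) \<le> K * (\<bar>x - p\<bar> powr \<rho> * norm (Lfun \<xi> x))" for x
      using mult_right_mono[OF K[of x p] norm_ge_zero[of "Lfun \<xi> x"]]
        order_trans[OF norm_ge_zero K[of x p]]
      by (auto simp: norm_mult ap mult.assoc[symmetric])
    have "(?g \<longlongrightarrow> 0) (at p)"
      by (rule Lim_null_comparison[OF always_eventually[OF allI, OF le] lim])
    with True show ?thesis by (simp add: isCont_def)
  next
    case False
    have "closed {x. cis (x - \<xi>) = 1}"
      by (intro closed_Collect_eq continuous_intros)
    then have "open {x. \<not> [x = \<xi>] (rmod (2 * pi))}"
      unfolding rcong_iff_cis cis_conv_exp[symmetric] by (rule open_Collect_neg)
    then have "eventually (\<lambda>x. \<not> [x = \<xi>] (rmod (2 * pi))) (nhds p)"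
      using False by (auto simp: eventually_nhds)
    then have ev: "eventually (\<lambda>x. ?g x = (a x - a \<xi>) * Lfun \<xi> x) (nhds p)"
      by eventually_elim simp
    have "isCont a p"
      using a Holder_circle_subset_C0_circle[OF \<rho>] continuous_on_eq_continuous_at[of UNIV a]
      by (auto simp: C0_circle_def)
    then have "isCont (\<lambda>x. (a x - a \<xi>) * Lfun \<xi> x) p"
      using isCont_Lfun[OF False] by (intro continuous_intros)
    then show ?thesis by (subst isCont_cong[OF ev])
  qed
  moreover have "periodic_2pi ?g"
  proof
    fix x
    have "[x + 2 * pi = \<xi>] (rmod (2 * pi)) \<longleftrightarrow> [x = \<xi>] (rmod (2 * pi))"
      using cis_eq_iff[of "x + 2 * pi" \<xi>] cis_eq_iff[of x \<xi>] by (simp add: complex_eq_iff)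
    then show "?g (x + 2 * pi) = ?g x" by (simp add: a.plus_period L.plus_period)
  qed
  ultimately show ?thesis
    by (simp add: C0_circle_def continuous_at_imp_continuous_on)
qed

section \<open>Countable exceptional sets\<close>

lemma countable_singular_points: "countable (singular_points N \<xi>)"
proof -
  have "singular_points N \<xi> = (\<Union>\<nu>\<in>{1..N}. {x. [x = \<xi> \<nu>] (rmod (2 * pi))})"
    by (auto simp: singular_points_def)
  then show ?thesis by (simp add: countable_rcong)
qed

text \<open>
  Changing an integrand on a countable set affects neither its integrability nor its integral, and
  a non-integrable function has integral \<open>0\<close>; hence equality for arbitrary \<open>f\<close> and \<open>g\<close>.
\<close>
lemma distr_of_cong:
  assumes "countable S" "\<And>x. x \<notin> S \<Longrightarrow> f x = g x"
  shows "distr_of f = distr_of g"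
proof
  fix \<phi>
  show "distr_of f \<phi> = distr_of g \<phi>"
    unfolding distr_of_def set_lebesgue_integral_def
    by (rule integral_discrete_difference[OF assms(1)]) (use assms(2) in auto)
qed

lemma Lfun_sum_in_L1_circle:
  assumes C: "C \<in> C0_circle" and v: "periodic_2pi v"
    and v_eq: "\<And>x. x \<notin> singular_points N \<xi> \<Longrightarrow> v x = (\<Sum>\<nu>=1..N. c \<nu> * Lfun (\<xi> \<nu>) x) + C x"
  shows "v \<in> L1_circle"
proof -
  have "(\<lambda>x. (\<Sum>\<nu>=1..N. c \<nu> * Lfun (\<xi> \<nu>) x) + C x) absolutely_integrable_on {0..2*pi}"
  proof (intro set_integral_add absolutely_integrable_sum set_integrable_mult_right absolutely_integrable_Lfun)
    show "C absolutely_integrable_on {0..2*pi}"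
      using C by (intro absolutely_integrable_continuous_real) (auto simp: C0_circle_def intro: continuous_on_subset)
  qed auto
  then have "v absolutely_integrable_on {0..2*pi}"
    by (rule absolutely_integrable_spike[where S = "singular_points N \<xi>"])
       (use v_eq in \<open>auto simp: negligible_iff_null_sets countable_singular_points
          intro!: null_sets_completionI countable_imp_null_set_lborel\<close>)
  with v show ?thesis by (simp add: L1_circle_def)
qed

section \<open>Multiplication of logarithmic singularities\<close>

theorem proposition2p2:
  fixes \<rho> :: real and a C :: "real \<Rightarrow> complex"
    and N :: nat and \<xi> :: "nat \<Rightarrow> real" and \<Gamma> :: "nat \<Rightarrow> complex"
    and vD :: "(real \<Rightarrow> complex) \<Rightarrow> complex" and v :: "real \<Rightarrow> complex"
  assumes \<rho>: "0 < \<rho>" "\<rho> \<le> 1"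
    and a: "a \<in> Holder_circle \<rho>"
    and C: "C \<in> C0_circle"
    and vD: "is_distribution vD"
    and vD_eq: "vD =\<^sub>D distr_of (\<lambda>x. (\<Sum>\<nu>=1..N. \<Gamma> \<nu> * Lfun (\<xi> \<nu>) x) + C x)"
    and v: "periodic_2pi v"
    and v_eq: "\<And>x. x \<notin> singular_points N \<xi> \<Longrightarrow>
                 v x = (\<Sum>\<nu>=1..N. \<Gamma> \<nu> * Lfun (\<xi> \<nu>) x) + C x"
  shows
    "v \<in> L1_circle \<and> vD =\<^sub>D distr_of v \<and> (\<lambda>x. a x * v x) \<in> L1_circle \<and>
     (\<exists>C\<^sub>a \<in> C0_circle.
        distr_of (\<lambda>x. a x * v x)
          =\<^sub>D distr_of (\<lambda>x. (\<Sum>\<nu>=1..N. a (\<xi> \<nu>) * \<Gamma> \<nu> * Lfun (\<xi> \<nu>) x) + C\<^sub>a x) \<and>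
        (\<forall>x. x \<notin> singular_points N \<xi> \<longrightarrow>
           a x * v x = (\<Sum>\<nu>=1..N. a (\<xi> \<nu>) * \<Gamma> \<nu> * Lfun (\<xi> \<nu>) x) + C\<^sub>a x)) \<and>
     \<comment> \<open>\<open>U\<close> as a function, defined away from the singular points\<close>
     (\<forall>(r :: real \<Rightarrow> real) \<in> C0_circle. \<forall>U :: real \<Rightarrow> real.
        periodic_2pi U \<longrightarrow>
        (\<forall>x. x \<notin> singular_points N \<xi> \<longrightarrow> U x = 2 * Re (a x * \<i> * v x) + r x) \<longrightarrow>
        (\<exists>(R :: real \<Rightarrow> real) \<in> C0_circle.
           (\<forall>x. x \<notin> singular_points N \<xi> \<longrightarrow>
              U x = 2 * Re (\<Sum>\<nu>=1..N. \<i> * a (\<xi> \<nu>) * \<Gamma> \<nu> * Lfun (\<xi> \<nu>) x) + R x \<and>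
              U x = (\<Sum>\<nu>=1..N. 2 * Re (\<i> * a (\<xi> \<nu>) * \<Gamma> \<nu>) * Cfun (\<xi> \<nu>) x
                               + (- 2 * Im (\<i> * a (\<xi> \<nu>) * \<Gamma> \<nu>)) * Jfun (\<xi> \<nu>) x) + R x))) \<and>
     \<comment> \<open>\<open>U\<close> as a distribution\<close>
     (\<forall>(r :: real \<Rightarrow> real) \<in> C0_circle. \<forall>U :: (real \<Rightarrow> complex) \<Rightarrow> complex.
        is_distribution U \<longrightarrow>
        U =\<^sub>D distr_of (\<lambda>x. complex_of_real (2 * Re (a x * \<i> * v x) + r x)) \<longrightarrow>
        (\<exists>(R :: real \<Rightarrow> real) \<in> C0_circle.
           U =\<^sub>D distr_of (\<lambda>x. complex_of_real
                  (2 * Re (\<Sum>\<nu>=1..N. \<i> * a (\<xi> \<nu>) * \<Gamma> \<nu> * Lfun (\<xi> \<nu>) x) + R x)) \<and>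
           U =\<^sub>D distr_of (\<lambda>x. complex_of_real
                  ((\<Sum>\<nu>=1..N. 2 * Re (\<i> * a (\<xi> \<nu>) * \<Gamma> \<nu>) * Cfun (\<xi> \<nu>) x
                               + (- 2 * Im (\<i> * a (\<xi> \<nu>) * \<Gamma> \<nu>)) * Jfun (\<xi> \<nu>) x) + R x))))"
proof -
  let ?S = "singular_points N \<xi>"
  define h where "h \<nu> x = (if [x = \<xi> \<nu>] (rmod (2 * pi)) then 0
                             else (a x - a (\<xi> \<nu>)) * Lfun (\<xi> \<nu>) x)" for \<nu> x
  define Ca where "Ca x = (\<Sum>\<nu>=1..N. \<Gamma> \<nu> * h \<nu> x) + a x * C x" for x
  have cong: "distr_of f = distr_of g" if "\<And>x. x \<notin> ?S \<Longrightarrow> f x = g x" for f g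
    using countable_singular_points that by (rule distr_of_cong)
  have aC0: "a \<in> C0_circle"
    using a Holder_circle_subset_C0_circle[OF \<rho>(1)] by blast
  have h: "h \<nu> \<in> C0_circle" for \<nu>
    unfolding h_def by (rule Holder_times_Lfun_continuous[OF \<rho>(1) a])
  have Ca: "Ca \<in> C0_circle"
    using h aC0 C unfolding Ca_def[abs_def] C0_circle_def
    by (auto simp: periodic_fun_simple_def intro!: continuous_intros)
  have av: "a x * v x = (\<Sum>\<nu>=1..N. a (\<xi> \<nu>) * \<Gamma> \<nu> * Lfun (\<xi> \<nu>) x) + Ca x" if "x \<notin> ?S" for x
  proof -
    have "a x * (\<Gamma> \<nu> * Lfun (\<xi> \<nu>) x) = a (\<xi> \<nu>) * \<Gamma> \<nu> * Lfun (\<xi> \<nu>) x + \<Gamma> \<nu> * h \<nu> x"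
      if "\<nu> \<in> {1..N}" for \<nu>
      using \<open>x \<notin> ?S\<close> that by (auto simp: h_def singular_points_def algebra_simps)
    then show ?thesis
      by (simp add: v_eq[OF that] Ca_def distrib_left sum_distrib_left sum.distrib add.assoc)
  qed
  have per: "periodic_2pi (\<lambda>x. a x * v x)"
    using aC0 v by (auto simp: C0_circle_def periodic_fun_simple_def)
  have ReL: "2 * Re (\<Sum>\<nu>=1..N. \<i> * a (\<xi> \<nu>) * \<Gamma> \<nu> * Lfun (\<xi> \<nu>) x) =
      (\<Sum>\<nu>=1..N. 2 * Re (\<i> * a (\<xi> \<nu>) * \<Gamma> \<nu>) * Cfun (\<xi> \<nu>) x
                  + (- 2 * Im (\<i> * a (\<xi> \<nu>) * \<Gamma> \<nu>)) * Jfun (\<xi> \<nu>) x)" if "x \<notin> ?S" for x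
    unfolding Re_sum sum_distrib_left
  proof (rule sum.cong)
    fix \<nu> assume "\<nu> \<in> {1..N}"
    then have "Lfun (\<xi> \<nu>) x = Complex (Cfun (\<xi> \<nu>) x) (Jfun (\<xi> \<nu>) x)"
      using that by (intro Lfun_eq_Complex) (auto simp: singular_points_def)
    then show "2 * Re (\<i> * a (\<xi> \<nu>) * \<Gamma> \<nu> * Lfun (\<xi> \<nu>) x) =
      2 * Re (\<i> * a (\<xi> \<nu>) * \<Gamma> \<nu>) * Cfun (\<xi> \<nu>) x
      + (- 2 * Im (\<i> * a (\<xi> \<nu>) * \<Gamma> \<nu>)) * Jfun (\<xi> \<nu>) x"
      by (simp add: algebra_simps)
  qed simp
  have R: "(\<lambda>x. 2 * Re (\<i> * Ca x) + r x) \<in> C0_circle" if "r \<in> C0_circle" for r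
    using that Ca by (auto simp: C0_circle_def periodic_fun_simple_def intro!: continuous_intros)
  have U: "2 * Re (a x * \<i> * v x) + r x =
      2 * Re (\<Sum>\<nu>=1..N. \<i> * a (\<xi> \<nu>) * \<Gamma> \<nu> * Lfun (\<xi> \<nu>) x) + (2 * Re (\<i> * Ca x) + r x)"
    if "x \<notin> ?S" for x r
  proof -
    have "a x * \<i> * v x = \<i> * (a x * v x)" by simp
    also have "\<dots> = (\<Sum>\<nu>=1..N. \<i> * a (\<xi> \<nu>) * \<Gamma> \<nu> * Lfun (\<xi> \<nu>) x) + \<i> * Ca x"
      by (simp only: av[OF that] distrib_left sum_distrib_left mult.assoc)
    finally show ?thesis by simp
  qed
  show ?thesis
  proof (intro conjI ballI allI impI)
    show "v \<in> L1_circle" by (rule Lfun_sum_in_L1_circle[OF C v v_eq])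
    show "vD =\<^sub>D distr_of v"
      using vD_eq cong[OF v_eq] by simp
    show "(\<lambda>x. a x * v x) \<in> L1_circle"
      by (rule Lfun_sum_in_L1_circle[OF Ca per av])
    show "\<exists>C\<^sub>a\<in>C0_circle.
        distr_of (\<lambda>x. a x * v x)
          =\<^sub>D distr_of (\<lambda>x. (\<Sum>\<nu>=1..N. a (\<xi> \<nu>) * \<Gamma> \<nu> * Lfun (\<xi> \<nu>) x) + C\<^sub>a x) \<and>
        (\<forall>x. x \<notin> ?S \<longrightarrow>
           a x * v x = (\<Sum>\<nu>=1..N. a (\<xi> \<nu>) * \<Gamma> \<nu> * Lfun (\<xi> \<nu>) x) + C\<^sub>a x)"
      using Ca av cong[OF av] by (intro bexI[of _ Ca]) (auto simp: distr_eq_def)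
  next
    fix r U :: "real \<Rightarrow> real"
    assume r: "r \<in> C0_circle"
      and U_eq: "\<forall>x. x \<notin> ?S \<longrightarrow> U x = 2 * Re (a x * \<i> * v x) + r x"
    show "\<exists>R\<in>C0_circle. \<forall>x. x \<notin> ?S \<longrightarrow>
              U x = 2 * Re (\<Sum>\<nu>=1..N. \<i> * a (\<xi> \<nu>) * \<Gamma> \<nu> * Lfun (\<xi> \<nu>) x) + R x \<and>
              U x = (\<Sum>\<nu>=1..N. 2 * Re (\<i> * a (\<xi> \<nu>) * \<Gamma> \<nu>) * Cfun (\<xi> \<nu>) x
                               + (- 2 * Im (\<i> * a (\<xi> \<nu>) * \<Gamma> \<nu>)) * Jfun (\<xi> \<nu>) x) + R x"
    proof (intro bexI[OF _ R[OF r]] allI impI conjI)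
      fix x assume x: "x \<notin> ?S"
      show *: "U x = 2 * Re (\<Sum>\<nu>=1..N. \<i> * a (\<xi> \<nu>) * \<Gamma> \<nu> * Lfun (\<xi> \<nu>) x) + (2 * Re (\<i> * Ca x) + r x)"
        using U_eq x by (simp only: U[OF x] simp_thms)
      show "U x = (\<Sum>\<nu>=1..N. 2 * Re (\<i> * a (\<xi> \<nu>) * \<Gamma> \<nu>) * Cfun (\<xi> \<nu>) x
                          + (- 2 * Im (\<i> * a (\<xi> \<nu>) * \<Gamma> \<nu>)) * Jfun (\<xi> \<nu>) x) + (2 * Re (\<i> * Ca x) + r x)"
        using * by (simp only: ReL[OF x])
    qed
  next
    fix r :: "real \<Rightarrow> real" and U :: "(real \<Rightarrow> complex) \<Rightarrow> complex"
    assume r: "r \<in> C0_circle"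
      and U_eq: "U =\<^sub>D distr_of (\<lambda>x. complex_of_real (2 * Re (a x * \<i> * v x) + r x))"
    let ?R = "\<lambda>x. 2 * Re (\<i> * Ca x) + r x"
    have 1: "distr_of (\<lambda>x. complex_of_real (2 * Re (a x * \<i> * v x) + r x)) =
      distr_of (\<lambda>x. complex_of_real
        (2 * Re (\<Sum>\<nu>=1..N. \<i> * a (\<xi> \<nu>) * \<Gamma> \<nu> * Lfun (\<xi> \<nu>) x) + ?R x))"
      by (rule cong) (rule arg_cong[OF U])
    have 2: "\<dots> = distr_of (\<lambda>x. complex_of_real
        ((\<Sum>\<nu>=1..N. 2 * Re (\<i> * a (\<xi> \<nu>) * \<Gamma> \<nu>) * Cfun (\<xi> \<nu>) x
                    + (- 2 * Im (\<i> * a (\<xi> \<nu>) * \<Gamma> \<nu>)) * Jfun (\<xi> \<nu>) x) + ?R x))"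
      by (rule cong) (simp only: ReL not_False_eq_True)
    show "\<exists>R\<in>C0_circle.
           U =\<^sub>D distr_of (\<lambda>x. complex_of_real
                  (2 * Re (\<Sum>\<nu>=1..N. \<i> * a (\<xi> \<nu>) * \<Gamma> \<nu> * Lfun (\<xi> \<nu>) x) + R x)) \<and>
           U =\<^sub>D distr_of (\<lambda>x. complex_of_real
                  ((\<Sum>\<nu>=1..N. 2 * Re (\<i> * a (\<xi> \<nu>) * \<Gamma> \<nu>) * Cfun (\<xi> \<nu>) x
                               + (- 2 * Im (\<i> * a (\<xi> \<nu>) * \<Gamma> \<nu>)) * Jfun (\<xi> \<nu>) x) + R x))"
      by (intro bexI[OF _ R[OF r]] conjI; rule U_eq[unfolded 1] U_eq[unfolded 1 2])
  qed
qed

end
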